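(* Let $(f_\ell)_{\ell\in\mathbb N}$ be an admissible sequence of weight functions (as defined in the context) and let $S\subseteq\mathbb N$ with complement $E=\mathbb N\setminus S$. Assume $1,3,5\in S$ and $2,4\in E$. Let $n\ge 4$ be an integer with $n\equiv 1\pmod 3$. Then $\Delta_{E,\ell}(n)<0$ for all but finitely many $\ell$ (i.e. for all $\ell$ sufficiently large depending on $n$).
   Context: $\mathbb N=\{1,2,3,\dots\}$. An admissible sequence of weight functions is a sequence $(f_\ell)_{\ell\in\mathbb N}$ of functions $f_\ell:\mathbb N\to\mathbb N$ with $f_\ell(1)=1$ for all $\ell$ and $f_1\equiv 1$, for which there exist real-valued functions $\Phi,\Psi$ on $\mathbb N$ such that: (1) $n^{\Phi(\ell)}\le f_\ell(n)\le n^{\Psi(\ell)}$ for all $\ell,n\in\mathbb N$; (2) there is a positive number $B$ independent of $\ell$ with $0\le\Psi(\ell)-\Phi(\ell)\le B$ for all $\ell$; (3) $\lim_{\ell\to\infty}\Phi(\ell)=\infty$. For $S\subseteq\mathbb N$ with $1\in S$ and $E=\mathbb N\setminus S$ (the exception set), the numbers $p_{E,\ell}(n)$ are defined by the formal power series identity $\sum_{n=0}^\infty p_{E,\ell}(n)q^n=\prod_{n\in S}(1-q^n)^{-f_\ell(n)}$, and $\Delta_{E,\ell}(n):=p_{E,\ell}(n)^2-p_{E,\ell}(n-1)\,p_{E,\ell}(n+1)$ for $n\ge1$. *)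

theory Defs
  imports "HOL-Analysis.Analysis"
begin

(* The natural numbers of the source start at 1. They are modelled by the type nat restricted
   to {1..}; the values of f, Phi and Psi at 0 are irrelevant throughout. *)

definition admissible_weights :: "(nat \<Rightarrow> nat \<Rightarrow> nat) \<Rightarrow> bool" where
  "admissible_weights f \<longleftrightarrow>
     (\<forall>l\<ge>1. \<forall>n\<ge>1. f l n \<ge> 1) \<and>
     (\<forall>l\<ge>1. f l 1 = 1) \<and>
     (\<forall>n\<ge>1. f 1 n = 1) \<and>
     (\<exists>\<Phi> \<Psi> :: nat \<Rightarrow> real.
        (\<forall>l\<ge>1. \<forall>n\<ge>1. real n powr \<Phi> l \<le> real (f l n) \<and> real (f l n) \<le> real n powr \<Psi> l) \<and>
        (\<exists>B>0. \<forall>l\<ge>1. 0 \<le> \<Psi> l - \<Phi> l \<and> \<Psi> l - \<Phi> l \<le> B) \<and>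
        filterlim \<Phi> at_top sequentially)"

definition euler_factor :: "(nat \<Rightarrow> nat \<Rightarrow> nat) \<Rightarrow> nat set \<Rightarrow> nat \<Rightarrow> nat \<Rightarrow> real fps" where
  "euler_factor f E l k =
     (if k \<in> {1..} - E then inverse ((1 - fps_X ^ k) ^ f l k) else 1)"

(* The infinite product is taken in the library's metric on formal power series, i.e. coefficientwise
   stabilisation of the partial products; it converges by lemma euler_factor_has_prod below.
   The coefficients are natural numbers, but are kept in the reals so that inverses and
   subtraction behave as intended. *)
definition p_exc :: "(nat \<Rightarrow> nat \<Rightarrow> nat) \<Rightarrow> nat set \<Rightarrow> nat \<Rightarrow> nat \<Rightarrow> real" where
  "p_exc f E l n = fps_nth (\<Prod>k. euler_factor f E l k) n"

(* Meant for n \<ge> 1 only, since n - 1 is truncated subtraction. *)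
definition Delta_exc :: "(nat \<Rightarrow> nat \<Rightarrow> nat) \<Rightarrow> nat set \<Rightarrow> nat \<Rightarrow> nat \<Rightarrow> real" where
  "Delta_exc f E l n = (p_exc f E l n)\<^sup>2 - p_exc f E l (n - 1) * p_exc f E l (n + 1)"

lemma fps_X_power_dvd_euler_factor_diff: "fps_X ^ k dvd euler_factor f E l k - 1"
proof (cases "k \<in> {1..} - E")
  case True
  define u :: "real fps" where "u = (1 - fps_X ^ k) ^ f l k"
  have "fps_nth u 0 = 1"
    using True by (simp add: u_def fps_nth_power_0 power_0_left)
  hence inv: "inverse u * u = 1"
    by (intro inverse_mult_eq_1) simp
  have "u - 1 = ((1 - fps_X ^ k) - 1) * (\<Sum>i<f l k. (1 - fps_X ^ k) ^ i)"
    unfolding u_def by (rule power_diff_1_eq)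
  hence "u - 1 = fps_X ^ k * - (\<Sum>i<f l k. (1 - fps_X ^ k) ^ i)"
    by simp
  hence "fps_X ^ k dvd u - 1"
    by (rule dvdI)
  hence "fps_X ^ k dvd - inverse u * (u - 1)"
    by (rule dvd_mult)
  also have "- inverse u * (u - 1) = inverse u - 1"
    using inv by (simp only: right_diff_distrib mult_minus_left mult_1_right) simp
  finally show ?thesis
    using True by (simp add: euler_factor_def u_def)
next
  case False
  thus ?thesis by (simp only: euler_factor_def if_False) simp
qed

lemma fps_nth_mult_euler_factor:
  assumes "n < k"
  shows "fps_nth (h * euler_factor f E l k) n = fps_nth h n"
proof -
  obtain g where "euler_factor f E l k - 1 = fps_X ^ k * g"
    using fps_X_power_dvd_euler_factor_diff[of k f E l] by (elim dvdE)
  hence "euler_factor f E l k = 1 + fps_X ^ k * g"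
    by (metis add.commute diff_add_cancel)
  hence "h * euler_factor f E l k = h + fps_X ^ k * (h * g)"
    by (simp only: distrib_left mult_1_right mult.left_commute)
  thus ?thesis
    using assms by (simp add: fps_X_power_mult_nth)
qed

lemma fps_nth_prod_euler_factor:
  assumes "n \<le> N"
  shows "fps_nth (\<Prod>k\<le>N. euler_factor f E l k) n = fps_nth (\<Prod>k\<le>n. euler_factor f E l k) n"
  using assms
proof (induction N rule: dec_induct)
  case (step N)
  have "(\<Prod>k\<le>Suc N. euler_factor f E l k) = (\<Prod>k\<le>N. euler_factor f E l k) * euler_factor f E l (Suc N)"
    by (rule prod.atMost_Suc)
  thus ?case
    using step by (simp only: fps_nth_mult_euler_factor less_Suc_eq_le)
qed simp

lemma euler_factor_has_prod:
  "(\<lambda>k. euler_factor f E l k) has_prod (\<Prod>k. euler_factor f E l k)"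
proof -
  define P where "P = Abs_fps (\<lambda>n. fps_nth (\<Prod>k\<le>n. euler_factor f E l k) n)"
  have "(\<lambda>N. \<Prod>k\<le>N. euler_factor f E l k) \<longlonglongrightarrow> P"
  proof (rule tendsto_fpsI)
    fix n
    show "eventually (\<lambda>N. fps_nth (\<Prod>k\<le>N. euler_factor f E l k) n = fps_nth P n) sequentially"
      using eventually_ge_at_top[of n]
      by eventually_elim (simp only: P_def fps_nth_Abs_fps, rule fps_nth_prod_euler_factor)
  qed
  moreover have "fps_nth P 0 = 1"
    by (simp add: P_def euler_factor_def)
  hence "P \<noteq> 0" by auto
  ultimately have P: "raw_has_prod (euler_factor f E l) 0 P"
    by (simp add: raw_has_prod_def)
  have "fps_nth (euler_factor f E l k) 0 = 1" for k
    using fps_nth_mult_euler_factor[of 0 k 1 f E l] by (cases "k = 0") (auto simp: euler_factor_def)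
  hence nz: "euler_factor f E l k \<noteq> 0" for k
    by (metis fps_zero_nth zero_neq_one)
  have "Q = P" if "(\<lambda>k. euler_factor f E l k) has_prod Q" for Q
  proof -
    have "raw_has_prod (euler_factor f E l) 0 Q"
      using that nz by (simp add: has_prod_def)
    thus ?thesis
      using P LIMSEQ_unique by (simp add: raw_has_prod_def) blast
  qed
  moreover have "(\<lambda>k. euler_factor f E l k) has_prod P"
    using P by (simp add: has_prod_def)
  ultimately show ?thesis
    unfolding prodinf_def by (metis theI)
qed

end

theory Submission
  imports Defs
begin

text \<open>
  As \<open>l\<close> grows, the size of \<open>p_exc f E l n\<close> is governed by the largest product of the parts of a
  partition of \<open>n\<close> into parts other than 2 and 4. This maximal product is \<open>3 ^ m\<close> for
  \<open>n = 3 * m\<close> and for \<open>n = 3 * m + 1\<close>, but \<open>5 * 3 ^ (m - 1)\<close> for \<open>n = 3 * m + 2\<close>. Hence for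
  \<open>n = 3 * m + 1\<close> the quotient of \<open>p_exc f E l (n - 1) * p_exc f E l (n + 1)\<close> by
  \<open>(p_exc f E l n)\<^sup>2\<close> grows at least like a constant times \<open>(5 / 3) powr \<Phi> l\<close>.
\<close>

section \<open>Bounds for multiset coefficients\<close>

text \<open>The binomial is the product of \<open>(r + i) / i\<close> for i from 1 to
  \<open>j\<close>, and each factor is at most \<open>r + 1\<close>. It is used with
  \<open>r + 1 = f l k\<close>.\<close>

lemma multichoose_le_power: "(r + j) choose j \<le> Suc r ^ j"
proof (induction j)
  case (Suc j)
  have "Suc j * ((r + Suc j) choose Suc j) = Suc (r + j) * ((r + j) choose j)"
    by (simp only: Suc_times_binomial add_Suc_right)
  also have "\<dots> \<le> (Suc j * Suc r) * Suc r ^ j"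
    using Suc.IH by (intro mult_le_mono) simp_all
  finally show ?case
    by (simp only: mult.assoc Suc_mult_le_cancel1 power_Suc)
qed simp

text \<open>In the same product every numerator is at least \<open>r + 1\<close>, and the
  denominators multiply to \<open>fact j\<close>.\<close>

lemma power_le_fact_mult_multichoose: "Suc r ^ j \<le> fact j * ((r + j) choose j)"
proof (induction j)
  case (Suc j)
  have "Suc r ^ Suc j \<le> Suc (r + j) * (fact j * ((r + j) choose j))"
    using mult_le_mono[OF _ Suc.IH, of "Suc r" "Suc (r + j)"] by simp
  also have "\<dots> = fact j * (Suc j * ((r + Suc j) choose Suc j))"
    by (simp only: Suc_times_binomial add_Suc_right mult.left_commute)
  finally show ?case
    by (simp only: fact_Suc of_nat_id mult_ac)
qed simp

section \<open>Coefficients of Euler factors and of their product\<close>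

lemma fps_nth_compose_X_power:
  fixes a :: "'a :: comm_ring_1 fps"
  assumes "k > 0"
  shows "fps_nth (a oo fps_X ^ k) n = (if k dvd n then fps_nth a (n div k) else 0)"
proof -
  have "fps_nth (a oo fps_X ^ k) n = (\<Sum>i=0..n. if k dvd n \<and> i = n div k then fps_nth a i else 0)"
    unfolding fps_compose_nth using assms
    by (intro sum.cong refl) (auto simp: fps_X_power_nth simp flip: power_mult)
  thus ?thesis
    by (auto simp: sum.delta)
qed

text \<open>This is the negative binomial series with \<open>fps_X ^ k\<close> substituted for
  \<open>fps_X\<close>.\<close>

lemma fps_nth_inverse_one_minus_X_power:
  assumes "k > 0"
  shows "fps_nth (inverse ((1 - fps_X ^ k) ^ Suc r) :: real fps) n =
    (if k dvd n then real ((r + n div k) choose (n div k)) else 0)"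
proof -
  have X0: "fps_nth (fps_X ^ k :: real fps) 0 = 0"
    using assms by simp
  have "(1 - fps_X ^ k) ^ Suc r = ((1 - fps_X) ^ Suc r) oo (fps_X ^ k :: real fps)"
    using assms by (simp only: fps_compose_power[OF X0, symmetric] fps_compose_sub_distrib
        fps_compose_1 fps_X_fps_compose_startby0[OF X0])
  hence "inverse ((1 - fps_X ^ k) ^ Suc r) = inverse ((1 - fps_X) ^ Suc r) oo (fps_X ^ k :: real fps)"
    using X0 by (simp only:) (subst fps_inverse_compose, auto simp: fps_nth_power_0 simp del: power_Suc)
  moreover have "inverse ((1 - fps_X) ^ Suc r) = Abs_fps (\<lambda>j. real ((r + j) choose j))"
    using one_minus_const_fps_X_neg_power'[of "Suc r" "1 :: real"] by simp
  ultimately show ?thesis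
    using assms by (simp only: fps_nth_compose_X_power fps_nth_Abs_fps)
qed

lemma fps_nth_euler_factor:
  assumes "k \<in> {1..} - E" "f l k \<ge> 1"
  shows "fps_nth (euler_factor f E l k) n =
    (if k dvd n then real ((f l k - 1 + n div k) choose (n div k)) else 0)"
  using assms fps_nth_inverse_one_minus_X_power[of k "f l k - 1" n] by (simp add: euler_factor_def)

text \<open>No factor vanishes, so the infinite product is the plain limit of its partial products,
  and factors beyond \<open>n\<close> leave coefficient \<open>n\<close> unchanged.\<close>

lemma p_exc_eq_prod:
  assumes "n \<le> N"
  shows "p_exc f E l n = fps_nth (\<Prod>k\<le>N. euler_factor f E l k) n"
proof -
  have "fps_nth (euler_factor f E l k) 0 = 1" for k
    using fps_nth_mult_euler_factor[of 0 k 1 f E l] by (cases "k = 0") (auto simp: euler_factor_def)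
  hence "euler_factor f E l k \<noteq> 0" for k
    by (metis fps_zero_nth zero_neq_one)
  hence "raw_has_prod (euler_factor f E l) 0 (\<Prod>k. euler_factor f E l k)"
    using euler_factor_has_prod[of f E l] by (simp add: has_prod_def)
  hence "(\<lambda>N. \<Prod>k\<le>N. euler_factor f E l k) \<longlonglongrightarrow> (\<Prod>k. euler_factor f E l k)"
    by (simp add: raw_has_prod_def)
  hence "eventually (\<lambda>M. fps_nth (\<Prod>k\<le>M. euler_factor f E l k) n = p_exc f E l n) sequentially"
    by (simp add: tendsto_fps_iff p_exc_def)
  then obtain M where "M \<ge> n" "fps_nth (\<Prod>k\<le>M. euler_factor f E l k) n = p_exc f E l n"
    unfolding eventually_sequentially by (meson linear)
  thus ?thesis
    using fps_nth_prod_euler_factor[of n M f E l] fps_nth_prod_euler_factor[OF assms, of f E l] by simp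
qed

section \<open>Products of series with nonnegative coefficients\<close>

lemma fps_nth_prod_nonneg:
  fixes F :: "'b \<Rightarrow> real fps"
  assumes "\<And>k i. k \<in> A \<Longrightarrow> 0 \<le> fps_nth (F k) i"
  shows "0 \<le> fps_nth (\<Prod>k\<in>A. F k) n"
  using assms
  by (induction A arbitrary: n rule: infinite_finite_induct)
    (auto simp: fps_mult_nth fps_one_nth intro!: sum_nonneg mult_nonneg_nonneg)

lemma fps_nth_mult_ge:
  fixes a b :: "real fps"
  assumes "\<And>i. 0 \<le> fps_nth a i" "\<And>i. 0 \<le> fps_nth b i"
  shows "fps_nth a i * fps_nth b j \<le> fps_nth (a * b) (i + j)"
proof -
  have "fps_nth a i * fps_nth b (i + j - i) \<le> (\<Sum>m=0..i + j. fps_nth a m * fps_nth b (i + j - m))"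
    using assms by (intro member_le_sum) auto
  thus ?thesis
    by (simp add: fps_mult_nth)
qed

text \<open>Each further factor is a convolution with \<open>n + 1\<close> terms, each controlled by
  \<open>h i * h (n - i) \<le> h n\<close>; so it costs only a factor \<open>n + 1\<close>.\<close>

lemma fps_nth_prod_le_supermult:
  fixes F :: "'b \<Rightarrow> real fps" and h :: "nat \<Rightarrow> real"
  assumes "finite A"
    and F: "\<And>k i. k \<in> A \<Longrightarrow> 0 \<le> fps_nth (F k) i" "\<And>k i. k \<in> A \<Longrightarrow> fps_nth (F k) i \<le> h i"
    and h: "\<And>i. 1 \<le> h i" "\<And>i j. h i * h j \<le> h (i + j)"
  shows "fps_nth (\<Prod>k\<in>A. F k) n \<le> real (n + 1) ^ card A * h n"
  using \<open>finite A\<close> F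
proof (induction A arbitrary: n rule: finite_induct)
  case empty
  show ?case
    using h(1)[of n] by (auto simp: fps_one_nth)
next
  case (insert k A)
  have h0: "0 \<le> h i" for i
    using h(1)[of i] by linarith
  have "fps_nth (\<Prod>k\<in>insert k A. F k) n =
      (\<Sum>i=0..n. fps_nth (F k) i * fps_nth (\<Prod>k\<in>A. F k) (n - i))"
    using insert.hyps by (simp add: fps_mult_nth)
  also have "\<dots> \<le> (\<Sum>i=0..n. real (n + 1) ^ card A * h n)"
  proof (intro sum_mono)
    fix i assume i: "i \<in> {0..n}"
    have "fps_nth (F k) i * fps_nth (\<Prod>k\<in>A. F k) (n - i) \<le>
        h i * (real (n - i + 1) ^ card A * h (n - i))"
      using insert h0 by (intro mult_mono fps_nth_prod_nonneg) auto
    also have "\<dots> \<le> h i * (real (n + 1) ^ card A * h (n - i))"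
      using h0 by (intro mult_left_mono mult_right_mono power_mono) auto
    also have "\<dots> = real (n + 1) ^ card A * (h i * h (n - i))"
      by (simp only: mult.left_commute)
    also have "\<dots> \<le> real (n + 1) ^ card A * h n"
      using h(2)[of i "n - i"] i by (intro mult_left_mono) auto
    finally show "fps_nth (F k) i * fps_nth (\<Prod>k\<in>A. F k) (n - i) \<le> real (n + 1) ^ card A * h n" .
  qed
  also have "\<dots> = real (n + 1) ^ card (insert k A) * h n"
    using insert.hyps by (simp add: algebra_simps)
  finally show ?case .
qed

section \<open>Maximal products of parts\<close>

text \<open>
  The largest product of the parts of a partition of \<open>n\<close> avoiding the parts 2 and 4.
\<close>

fun max_part_prod :: "nat \<Rightarrow> nat" where
  "max_part_prod 0 = 1"
| "max_part_prod (Suc 0) = 1"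
| "max_part_prod (Suc (Suc 0)) = 1"
| "max_part_prod (Suc (Suc (Suc n))) = (if n = 2 then 5 else 3 * max_part_prod n)"

lemma max_part_prod_ge_1: "1 \<le> max_part_prod n"
  by (induction n rule: max_part_prod.induct) auto

lemma max_part_prod_step: "3 * max_part_prod n \<le> max_part_prod (Suc (Suc (Suc n)))"
  by (simp add: numeral_2_eq_2)

lemma max_part_prod_le_Suc: "max_part_prod n \<le> max_part_prod (Suc n)"
  by (induction n rule: max_part_prod.induct) (auto simp: eval_nat_numeral)

text \<open>Handles the exceptional branch of the recursion in the next lemma. The critical case is
  two fives, where 25 \<le> 27 because 10 = 3 + 3 + 3 + 1.\<close>

lemma max_part_prod_five: "5 * max_part_prod n \<le> max_part_prod (n + 5)"
  by (induction n rule: max_part_prod.induct) (auto simp: eval_nat_numeral)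

text \<open>Partitions of \<open>a\<close> and \<open>b\<close> can be joined. The induction peels a
  three off \<open>a\<close>, or a five when \<open>a\<close> is 5.\<close>

lemma max_part_prod_supermult: "max_part_prod a * max_part_prod b \<le> max_part_prod (a + b)"
proof (induction a rule: max_part_prod.induct)
  case 2
  show ?case using max_part_prod_le_Suc[of b] by simp
next
  case 3
  show ?case using max_part_prod_le_Suc[of b] max_part_prod_le_Suc[of "Suc b"] by simp
next
  case (4 a)
  show ?case
  proof (cases "a = 2")
    case True
    thus ?thesis using max_part_prod_five[of b] by (simp add: eval_nat_numeral)
  next
    case False
    thus ?thesis using 4 max_part_prod_step[of "a + b"] by simp
  qed
qed simp

text \<open>For allowed \<open>n\<close> the single part \<open>n\<close> is a partition. At 2 and 4
  the maximum drops to 1 and 3, which is the effect of excluding these parts.\<close>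

lemma le_max_part_prod:
  assumes "n \<noteq> 2" "n \<noteq> 4"
  shows "n \<le> max_part_prod n"
  using assms
proof (induction n rule: max_part_prod.induct)
  case (4 n)
  consider "n = 0" | "n = 1" | "n = 2" | "n = 4" | "n \<ge> 3" "n \<noteq> 4"
    by linarith
  thus ?case
    using 4 by cases (auto simp: eval_nat_numeral)
qed auto

lemma power_le_max_part_prod:
  assumes "k \<noteq> 2" "k \<noteq> 4"
  shows "k ^ j \<le> max_part_prod (k * j)"
proof (induction j)
  case (Suc j)
  have "k * k ^ j \<le> max_part_prod k * max_part_prod (k * j)"
    using Suc le_max_part_prod[OF assms] by (rule mult_le_mono[rotated])
  also have "\<dots> \<le> max_part_prod (k * Suc j)"
    using max_part_prod_supermult[of k "k * j"] by simp
  finally show ?case by simp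
qed simp

lemma max_part_prod_3_mult_plus_1: "max_part_prod (3 * m + 1) = 3 ^ m"
proof (induction m)
  case (Suc m)
  have "3 * Suc m + 1 = Suc (Suc (Suc (3 * m + 1)))" "3 * m + 1 \<noteq> 2"
    by presburger+
  thus ?case
    using Suc by (simp only: max_part_prod.simps if_False power_Suc)
qed simp

section \<open>Upper and lower bounds for \<open>p_exc\<close>\<close>

lemma euler_factor_nonneg:
  assumes "\<forall>k\<ge>1. f l k \<ge> 1"
  shows "0 \<le> fps_nth (euler_factor f E l k) i"
proof (cases "k \<in> {1..} - E")
  case True
  thus ?thesis using assms by (simp add: fps_nth_euler_factor)
qed (simp only: euler_factor_def if_False, simp)

text \<open>The coefficient at \<open>k * j\<close> is at most \<open>f l k ^ j\<close>, hence at
  most \<open>(k ^ j) powr \<psi>\<close>, and \<open>k ^ j\<close> is the product of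
  \<open>j\<close> equal parts.\<close>

lemma euler_factor_le:
  assumes f: "\<forall>k\<ge>1. f l k \<ge> 1" "\<forall>k\<ge>1. real (f l k) \<le> real k powr \<psi>"
    and "0 \<le> \<psi>" "2 \<in> E" "4 \<in> E"
  shows "fps_nth (euler_factor f E l k) i \<le> real (max_part_prod i) powr \<psi>"
proof -
  have ge1: "1 \<le> real (max_part_prod i) powr \<psi>"
    using max_part_prod_ge_1[of i] \<open>0 \<le> \<psi>\<close> by (intro ge_one_powr_ge_zero) auto
  consider "k \<notin> {1..} - E" | "k \<in> {1..} - E" "\<not> k dvd i" | j where "k \<in> {1..} - E" "i = k * j"
    by (auto elim: dvdE)
  thus ?thesis
  proof cases
    case 1
    hence "euler_factor f E l k = 1"
      by (simp only: euler_factor_def if_False)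
    thus ?thesis using ge1 by (simp add: fps_one_nth)
  next
    case 2
    thus ?thesis using f by (simp add: fps_nth_euler_factor)
  next
    case (3 j)
    hence k: "k \<ge> 1" "k \<noteq> 2" "k \<noteq> 4"
      using assms by auto
    have "f l k \<ge> 1"
      using f k by blast
    hence "(f l k - 1 + j) choose j \<le> f l k ^ j"
      using multichoose_le_power[of "f l k - 1" j] by simp
    hence "real ((f l k - 1 + j) choose j) \<le> real (f l k) ^ j"
      unfolding of_nat_power[symmetric] of_nat_le_iff .
    also have "\<dots> \<le> (real k powr \<psi>) ^ j"
      using f k by (intro power_mono) auto
    also have "\<dots> = real (k ^ j) powr \<psi>"
      using k by (simp add: powr_powr powr_power mult.commute flip: powr_realpow)
    also have "\<dots> \<le> real (max_part_prod i) powr \<psi>"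
      using power_le_max_part_prod[OF k(2,3), of j] 3 \<open>0 \<le> \<psi>\<close> by (intro powr_mono2) auto
    finally show ?thesis
      using 3 f k by (simp add: fps_nth_euler_factor)
  qed
qed

lemma p_exc_nonneg:
  assumes "\<forall>k\<ge>1. f l k \<ge> 1"
  shows "0 \<le> p_exc f E l n"
  unfolding p_exc_eq_prod[OF order_refl]
  using euler_factor_nonneg[of f l, OF assms] by (intro fps_nth_prod_nonneg)

lemma p_exc_le:
  assumes "\<forall>k\<ge>1. f l k \<ge> 1" "\<forall>k\<ge>1. real (f l k) \<le> real k powr \<psi>"
    and "0 \<le> \<psi>" "2 \<in> E" "4 \<in> E"
  shows "p_exc f E l n \<le> real (n + 1) ^ (n + 1) * real (max_part_prod n) powr \<psi>"
proof -
  have "fps_nth (\<Prod>k\<le>n. euler_factor f E l k) n \<le>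
      real (n + 1) ^ card {..n} * real (max_part_prod n) powr \<psi>"
  proof (rule fps_nth_prod_le_supermult)
    show "1 \<le> real (max_part_prod i) powr \<psi>" for i
      using max_part_prod_ge_1[of i] \<open>0 \<le> \<psi>\<close> by (intro ge_one_powr_ge_zero) auto
    show "real (max_part_prod i) powr \<psi> * real (max_part_prod j) powr \<psi> \<le>
        real (max_part_prod (i + j)) powr \<psi>" for i j
      using max_part_prod_supermult[of i j] \<open>0 \<le> \<psi>\<close>
      by (simp add: powr_mono2 flip: powr_mult of_nat_mult)
  qed (use assms in \<open>auto intro: euler_factor_nonneg euler_factor_le\<close>)
  thus ?thesis
    by (simp add: p_exc_eq_prod[OF order_refl])
qed

text \<open>Keeps only the contribution of the partition into \<open>i\<close> threes and
  \<open>j\<close> fives; all others are nonnegative.\<close>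

lemma p_exc_ge:
  assumes f: "\<forall>k\<ge>1. f l k \<ge> 1" and "3 \<notin> E" "5 \<notin> E"
  shows "real (f l 3) ^ i * real (f l 5) ^ j / (fact i * fact j) \<le> p_exc f E l (3 * i + 5 * j)"
proof -
  let ?F = "euler_factor f E l"
  \<comment> \<open>The summand 5 puts 3 and 5 into the index set even if \<open>i\<close> and
    \<open>j\<close> are 0.\<close>
  let ?A = "{..3 * i + 5 * j + 5}"
  let ?R = "\<Prod>k\<in>?A - {3} - {5}. ?F k"
  note nonneg = euler_factor_nonneg[of f l, OF f]
  have ge: "real (f l k) ^ m / fact m \<le> fps_nth (?F k) (k * m)" if "k \<in> {1..} - E" for k m
  proof -
    have "f l k \<ge> 1"
      using f that by simp
    hence "f l k ^ m \<le> fact m * ((f l k - 1 + m) choose m)"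
      using power_le_fact_mult_multichoose[of "f l k - 1" m] by simp
    hence "real (f l k) ^ m \<le> fact m * real ((f l k - 1 + m) choose m)"
      unfolding of_nat_fact[symmetric, where 'a = real] of_nat_power[symmetric] of_nat_mult[symmetric]
        of_nat_le_iff .
    thus ?thesis
      using f that by (simp add: fps_nth_euler_factor field_simps)
  qed
  have F0: "fps_nth (?F k) 0 = 1" for k
    using f by (cases "k \<in> {1..} - E") (simp add: fps_nth_euler_factor, simp only: euler_factor_def if_False, simp)
  have R0: "fps_nth ?R 0 = 1"
  proof -
    have "fps_nth (\<Prod>k\<in>A. ?F k) 0 = 1" for A
      by (induction A rule: infinite_finite_induct) (simp_all add: F0)
    thus ?thesis .
  qed
  have Rn: "0 \<le> fps_nth ?R m" for m
    using nonneg by (intro fps_nth_prod_nonneg)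
  have FR: "0 \<le> fps_nth (?F 5 * ?R) m" for m
    using nonneg Rn by (auto simp: fps_mult_nth intro!: sum_nonneg mult_nonneg_nonneg)
  have "real (f l 3) ^ i * real (f l 5) ^ j / (fact i * fact j) =
      (real (f l 3) ^ i / fact i) * (real (f l 5) ^ j / fact j)"
    by simp
  also have "\<dots> \<le> fps_nth (?F 3) (3 * i) * fps_nth (?F 5) (5 * j)"
    using assms nonneg by (intro mult_mono ge) auto
  \<comment> \<open>From the remaining factors only the constant term 1 is taken.\<close>
  also have "\<dots> \<le> fps_nth (?F 3) (3 * i) * fps_nth (?F 5 * ?R) (5 * j)"
    using fps_nth_mult_ge[of "?F 5" ?R "5 * j" 0, OF nonneg Rn] R0 nonneg
    by (intro mult_left_mono) auto
  also have "\<dots> \<le> fps_nth (?F 3 * (?F 5 * ?R)) (3 * i + 5 * j)"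
    by (rule fps_nth_mult_ge[OF nonneg FR])
  also have "?F 3 * (?F 5 * ?R) = (\<Prod>k\<in>?A. ?F k)"
    by (simp add: prod.remove[of ?A 3] prod.remove[of "?A - {3}" 5])
  also have "fps_nth \<dots> (3 * i + 5 * j) = p_exc f E l (3 * i + 5 * j)"
    by (rule p_exc_eq_prod[symmetric]) simp
  finally show ?thesis .
qed

section \<open>Comparison of growth in \<open>l\<close>\<close>

theorem theorem2p5:
  fixes f :: "nat \<Rightarrow> nat \<Rightarrow> nat" and S E :: "nat set" and n :: nat
  assumes "admissible_weights f"
    and "S \<subseteq> {1..}" and "E = {1..} - S"
    and "1 \<in> S" "3 \<in> S" "5 \<in> S" and "2 \<in> E" "4 \<in> E"
    and "n \<ge> 4" and "n mod 3 = 1"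
  shows "eventually (\<lambda>l. Delta_exc f E l n < 0) sequentially"
proof -
  obtain \<Phi> \<Psi> :: "nat \<Rightarrow> real" and B where f1: "\<forall>l\<ge>1. \<forall>k\<ge>1. f l k \<ge> 1"
    and \<Phi>: "\<forall>l\<ge>1. \<forall>k\<ge>1. real k powr \<Phi> l \<le> real (f l k)"
    and \<Psi>: "\<forall>l\<ge>1. \<forall>k\<ge>1. real (f l k) \<le> real k powr \<Psi> l"
    and B: "\<forall>l\<ge>1. 0 \<le> \<Psi> l - \<Phi> l \<and> \<Psi> l - \<Phi> l \<le> B"
    and lim: "filterlim \<Phi> at_top sequentially"
    using \<open>admissible_weights f\<close> unfolding admissible_weights_def
    by (elim conjE exE) (rule that, simp_all)
  \<comment> \<open>With this \<open>m\<close>, the number \<open>n - 1\<close> splits into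
    \<open>m + 1\<close> threes, and \<open>n + 1 = 3 * m + 5\<close> into \<open>m\<close> threes
    and one five.\<close>
  define m where "m = n div 3 - 1"
  have n: "n = 3 * Suc m + 1"
    using \<open>n \<ge> 4\<close> \<open>n mod 3 = 1\<close> unfolding m_def by presburger
  have E: "3 \<notin> E" "5 \<notin> E"
    using assms by auto
  define C where "C = real (n + 1) ^ (n + 1)"
  define D :: real where "D = fact (Suc m) * fact m"
  \<comment> \<open>\<open>K\<close> collects all constants independent of \<open>l\<close>: the
    squared constant of the upper bound and the factorials of the two lower bounds.\<close>
  define K where "K = (C * (3 ^ Suc m) powr B)\<^sup>2 * D"
  have D: "D > 0"
    by (simp add: D_def)
  \<comment> \<open>The \<open>max\<close> with 1 keeps the argument of the logarithm
    positive.\<close>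
  have "(5 / 3) powr x > K" if "x > log (5 / 3) (max K 1)" for x
    using powr_less_mono[OF that, of "5 / 3"] by simp
  moreover have "eventually (\<lambda>l. \<Phi> l > log (5 / 3) (max K 1)) sequentially"
    using lim by (simp add: filterlim_at_top_dense)
  ultimately have "eventually (\<lambda>l. (5 / 3) powr \<Phi> l > K) sequentially"
    by (auto elim: eventually_mono)
  \<comment> \<open>This makes \<open>\<Psi> l\<close> nonnegative, as \<open>p_exc_le\<close>
    requires.\<close>
  moreover have "eventually (\<lambda>l. \<Phi> l \<ge> 0) sequentially"
    using lim by (simp add: filterlim_at_top)
  ultimately show ?thesis
    using eventually_ge_at_top[of 1]
  proof eventually_elim
    case (elim l)
    define T where "T = (3 :: real) powr \<Phi> l"
    have T: "T > 0"
      by (simp add: T_def)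
    \<comment> \<open>The single five supplies the missing power of \<open>T\<close> and the gain
      \<open>(5 / 3) powr \<Phi> l\<close>.\<close>
    have five: "5 powr \<Phi> l = T * (5 / 3) powr \<Phi> l"
      by (simp add: T_def flip: powr_mult)
    have fl: "\<forall>k\<ge>1. f l k \<ge> 1" "\<forall>k\<ge>1. real (f l k) \<le> real k powr \<Psi> l"
      and B': "\<Phi> l \<le> \<Psi> l" "\<Psi> l \<le> \<Phi> l + B"
      using f1 \<Psi> B elim by force+
    have "p_exc f E l n \<le> C * (3 ^ Suc m) powr \<Psi> l"
      using p_exc_le[of f l, OF fl, of E n] \<open>2 \<in> E\<close> \<open>4 \<in> E\<close> elim B' max_part_prod_3_mult_plus_1[of "Suc m"]
      by (simp only: C_def n) simp
    \<comment> \<open>Passing from \<open>\<Psi>\<close> to \<open>\<Phi>\<close> costs a factor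
      independent of \<open>l\<close>, so both sides can be compared in powers of
      \<open>T\<close>.\<close>
    also have "\<dots> \<le> C * (3 ^ Suc m) powr (\<Phi> l + B)"
      using B' one_le_power[of "3 :: real" "Suc m"]
      by (intro mult_left_mono powr_mono) (simp_all add: C_def)
    also have "\<dots> = C * (3 ^ Suc m) powr B * T ^ Suc m"
      by (simp only: powr_add T_def powr_realpow[symmetric] powr_powr zero_less_numeral powr_gt_zero)
        (simp add: mult_ac powr_powr powr_realpow powr_power)
    finally have "p_exc f E l n \<le> C * (3 ^ Suc m) powr B * T ^ Suc m" .
    hence "(p_exc f E l n)\<^sup>2 \<le> (C * (3 ^ Suc m) powr B * T ^ Suc m)\<^sup>2"
      using p_exc_nonneg[of f l, OF fl(1)] by (intro power_mono)
    also have "\<dots> = K / D * (T ^ Suc m * T ^ Suc m)"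
      using D by (simp add: K_def power2_eq_square mult_ac)
    \<comment> \<open>Both sides carry \<open>T\<close> to the power \<open>2 * Suc m\<close>, so
      the choice of \<open>l\<close> with \<open>(5 / 3) powr \<Phi> l > K\<close> decides the
      inequality.\<close>
    also have "\<dots> < (5 / 3) powr \<Phi> l / D * (T ^ Suc m * T ^ Suc m)"
      using elim D T by (intro mult_strict_right_mono divide_strict_right_mono) auto
    also have "\<dots> = (T ^ Suc m / fact (Suc m)) * (T ^ m * 5 powr \<Phi> l / fact m)"
      unfolding five D_def by (simp add: mult_ac)
    also have "\<dots> \<le> p_exc f E l (3 * Suc m) * p_exc f E l (3 * m + 5)"
    proof (intro mult_mono)
      have T3: "T \<le> real (f l 3)" and T5: "5 powr \<Phi> l \<le> real (f l 5)"
        using \<Phi>[rule_format, of l 3] \<Phi>[rule_format, of l 5] elim by (simp_all add: T_def)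
      have "T ^ Suc m / fact (Suc m) \<le> real (f l 3) ^ Suc m / fact (Suc m)"
        using T3 T by (intro divide_right_mono power_mono) auto
      also have "\<dots> \<le> p_exc f E l (3 * Suc m)"
        using p_exc_ge[of f l, OF fl(1) E, of "Suc m" 0] by simp
      finally show "T ^ Suc m / fact (Suc m) \<le> p_exc f E l (3 * Suc m)" .
      have "T ^ m * 5 powr \<Phi> l / fact m \<le> real (f l 3) ^ m * real (f l 5) / fact m"
        using T3 T5 T by (intro divide_right_mono mult_mono power_mono) auto
      also have "\<dots> \<le> p_exc f E l (3 * m + 5)"
        using p_exc_ge[of f l, OF fl(1) E, of m 1] by simp
      finally show "T ^ m * 5 powr \<Phi> l / fact m \<le> p_exc f E l (3 * m + 5)" .
    qed (use T p_exc_nonneg[of f l, OF fl(1)] in auto)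
    finally show ?case
      by (simp add: Delta_exc_def n add.commute)
  qed
qed

end
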